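(* Let $b$ be a connected locally finite weighted graph over an at most countable set $V$ with values in an ordered field $\mathbb K$, let $\pi=\pi_V^b$ be the associated real transition matrix (with $U=V$), and let $a\in V$. (a) If $a$ is a recurrent state (with respect to $\pi$), then $G(a)=\infty$. (b) If $G(a)<\infty$, then $a$ is a transient state (with respect to $\pi$).
   Context: Let $(\mathbb K,\succ)$ be an ordered field and $\mathbb K^+=\{k\succ 0\}$. Weighted graph: a symmetric map $b:V\times V\to\mathbb K^+\cup\{0\}$ with $b(x,x)=0$; $x\sim y$ means $b(x,y)\succ 0$. Connected: any two vertices $x,y$ are joined by a path $x=x_0\sim\dots\sim x_n=y$. Locally finite: every vertex has finitely many neighbors. A subset is connected if the restriction of $b$ to it is connected. Put $b(x)=\sum_{y\in V}b(x,y)$ and $p(x,y)=b(x,y)/b(x)$ ($b(x)\succ0$ is automatic when $V$ has at least two elements). Real part: for $k\in\mathbb K$ with $|k|\prec c$ for some positive rational $c$, $\rho(k)$ is the unique real number such that $|k-\rho(k)|$ is smaller than every positive rational in an ordered field containing $\mathbb K$ and $\mathbb R$; equivalently $\rho(k)=\sup_{\mathbb R}\{q\in\mathbb Q: q\preceq k\}$. $\pi_V^b(x,y)=\rho(p(x,y))$ for $x,y\in V$; this is a real transition matrix. A state $x$ is recurrent if the Markov chain $(X_n)$ with transition matrix $\pi_V^b$ started at $x$ satisfies $\mathbb P[X_n=x\text{ for infinitely many }n]=1$, and transient otherwise. Capacity: $\Delta f(x)=\frac1{b(x)}\sum_{y}b(x,y)(f(x)-f(y))$ for $f:V\to\mathbb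 K$. For finite connected $K\subseteq V$ and $a\in K$ there is a unique $v:V\to\mathbb K$ with $\Delta v=0$ on $K\setminus\{a\}$, $v(a)=1$, $v=0$ on $V\setminus K$; it satisfies $0\preceq v\preceq 1$. Put $\operatorname{cap}_K(a)=b(a)\Delta v(a)$. Then $0\preceq\operatorname{cap}_K(a)/b(a)\preceq1$, and $G_K(a)=1/\rho\big(\operatorname{cap}_K(a)/b(a)\big)\in[1,\infty]$ with $1/0=\infty$. For an exhaustion $(K_n)$ of $V$ (increasing sequence of finite connected sets with union $V$) with $a\in K_0$, $G(a)=\limsup_{n\to\infty}G_{K_n}(a)\in[1,\infty]$ (the sequence is monotone increasing, so this is a limit). *)

theory Defs
  imports "HOL-Probability.Probability"
begin

text \<open>
  The vertex set is the whole carrier type \<^typ>\<open>'v\<close>; edge weights live in an arbitrary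
  (not necessarily Archimedean) linearly ordered field \<^typ>\<open>'k\<close>.
\<close>

definition weighted_graph :: "('v \<Rightarrow> 'v \<Rightarrow> 'k::linordered_field) \<Rightarrow> bool" where
  "weighted_graph b \<longleftrightarrow> (\<forall>x y. b x y = b y x) \<and> (\<forall>x y. 0 \<le> b x y) \<and> (\<forall>x. b x x = 0)"

definition neighbors :: "('v \<Rightarrow> 'v \<Rightarrow> 'k::linordered_field) \<Rightarrow> 'v \<Rightarrow> 'v set" where
  "neighbors b x = {y. 0 < b x y}"

definition locally_finite_graph :: "('v \<Rightarrow> 'v \<Rightarrow> 'k::linordered_field) \<Rightarrow> bool" where
  "locally_finite_graph b \<longleftrightarrow> (\<forall>x. finite (neighbors b x))"

definition connected_in :: "('v \<Rightarrow> 'v \<Rightarrow> 'k::linordered_field) \<Rightarrow> 'v set \<Rightarrow> bool" where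
  "connected_in b K \<longleftrightarrow>
     (\<forall>x\<in>K. \<forall>y\<in>K. (\<lambda>u w. u \<in> K \<and> w \<in> K \<and> 0 < b u w)\<^sup>*\<^sup>* x y)"

text \<open>
  Sums over all vertices are written as sums over the neighbors, which are finite sums for
  locally finite graphs; all omitted terms have the factor \<open>b x y = 0\<close>.
\<close>

definition vertex_weight :: "('v \<Rightarrow> 'v \<Rightarrow> 'k::linordered_field) \<Rightarrow> 'v \<Rightarrow> 'k" where
  "vertex_weight b x = (\<Sum>y\<in>neighbors b x. b x y)"

definition laplacian :: "('v \<Rightarrow> 'v \<Rightarrow> 'k::linordered_field) \<Rightarrow> ('v \<Rightarrow> 'k) \<Rightarrow> 'v \<Rightarrow> 'k" where
  "laplacian b f x = 1 / vertex_weight b x * (\<Sum>y\<in>neighbors b x. b x y * (f x - f y))"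

text \<open>Meaningful only for \<open>k\<close> bounded in absolute value by a rational.\<close>

definition real_part :: "'k::linordered_field \<Rightarrow> real" where
  "real_part k = Sup {real_of_rat q |q. of_rat q \<le> k}"

definition real_transition :: "('v \<Rightarrow> 'v \<Rightarrow> 'k::linordered_field) \<Rightarrow> 'v \<Rightarrow> 'v \<Rightarrow> real" where
  "real_transition b x y = real_part (b x y / vertex_weight b x)"

definition dirichlet_solution ::
    "('v \<Rightarrow> 'v \<Rightarrow> 'k::linordered_field) \<Rightarrow> 'v set \<Rightarrow> 'v \<Rightarrow> 'v \<Rightarrow> 'k" where
  "dirichlet_solution b K a =
     (THE v. (\<forall>x\<in>K - {a}. laplacian b v x = 0) \<and> v a = 1 \<and> (\<forall>x. x \<notin> K \<longrightarrow> v x = 0))"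

definition capacity :: "('v \<Rightarrow> 'v \<Rightarrow> 'k::linordered_field) \<Rightarrow> 'v set \<Rightarrow> 'v \<Rightarrow> 'k" where
  "capacity b K a = vertex_weight b a * laplacian b (dirichlet_solution b K a) a"

text \<open>In \<^typ>\<open>ereal\<close>, \<open>1 / 0 = \<infinity>\<close>, as needed for vanishing real part.\<close>

definition green_on :: "('v \<Rightarrow> 'v \<Rightarrow> 'k::linordered_field) \<Rightarrow> 'v set \<Rightarrow> 'v \<Rightarrow> ereal" where
  "green_on b K a = 1 / ereal (real_part (capacity b K a / vertex_weight b a))"

definition exhaustion :: "('v \<Rightarrow> 'v \<Rightarrow> 'k::linordered_field) \<Rightarrow> (nat \<Rightarrow> 'v set) \<Rightarrow> bool" where
  "exhaustion b K \<longleftrightarrow>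
     incseq K \<and> (\<forall>n. finite (K n) \<and> connected_in b (K n)) \<and> (\<Union>n. K n) = UNIV"

definition green :: "('v \<Rightarrow> 'v \<Rightarrow> 'k::linordered_field) \<Rightarrow> (nat \<Rightarrow> 'v set) \<Rightarrow> 'v \<Rightarrow> ereal" where
  "green b K a = limsup (\<lambda>n. green_on b (K n) a)"

text \<open>
  The law on path space of the Markov chain with transition matrix \<open>P\<close> started at \<open>x\<close>, by the
  Ionescu Tulcea construction: given the coordinates before time \<open>n\<close>, the \<open>n\<close>-th
  coordinate is distributed according to \<open>markov_step P x n \<omega>\<close>. The lemma
  \<open>markov_chain_path_measure\<close> below confirms the finite-dimensional distributions.
\<close>

definition markov_step ::
    "('v \<Rightarrow> 'v \<Rightarrow> real) \<Rightarrow> 'v \<Rightarrow> nat \<Rightarrow> (nat \<Rightarrow> 'v) \<Rightarrow> 'v measure" where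
  "markov_step P x n \<omega> =
     (if n = 0 then return (count_space UNIV) x
      else point_measure UNIV (\<lambda>y. ennreal (P (\<omega> (n - 1)) y)))"

definition path_measure :: "('v \<Rightarrow> 'v \<Rightarrow> real) \<Rightarrow> 'v \<Rightarrow> (nat \<Rightarrow> 'v) measure" where
  "path_measure P x =
     projective_family.lim UNIV
       (Ionescu_Tulcea.CI (markov_step P x) (\<lambda>_. count_space UNIV)) (\<lambda>_. count_space UNIV)"

definition recurrent_state :: "('v \<Rightarrow> 'v \<Rightarrow> real) \<Rightarrow> 'v \<Rightarrow> bool" where
  "recurrent_state P x \<longleftrightarrow>
     measure (path_measure P x) {\<omega> \<in> space (path_measure P x). infinite {n. \<omega> n = x}} = 1"

definition transient_state :: "('v \<Rightarrow> 'v \<Rightarrow> real) \<Rightarrow> 'v \<Rightarrow> bool" where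
  "transient_state P x \<longleftrightarrow> \<not> recurrent_state P x"

definition stochastic_matrix :: "('v \<Rightarrow> 'v \<Rightarrow> real) \<Rightarrow> bool" where
  "stochastic_matrix P \<longleftrightarrow> (\<forall>x y. 0 \<le> P x y) \<and> (\<forall>x. (P x has_sum 1) UNIV)"

definition markov_chain ::
    "'w measure \<Rightarrow> (nat \<Rightarrow> 'w \<Rightarrow> 'v) \<Rightarrow> ('v \<Rightarrow> 'v \<Rightarrow> real) \<Rightarrow> 'v \<Rightarrow> bool" where
  "markov_chain M X P x \<longleftrightarrow>
     prob_space M \<and> (\<forall>n. X n \<in> measurable M (count_space UNIV)) \<and>
     (\<forall>n w. measure M {\<omega> \<in> space M. \<forall>i\<le>n. X i \<omega> = w i} =
        (if w 0 = x then \<Prod>i<n. P (w i) (w (Suc i)) else 0))"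

lemma Ionescu_Tulcea_markov_step:
  fixes P :: "'v::countable \<Rightarrow> 'v \<Rightarrow> real"
  assumes "stochastic_matrix P"
  shows "Ionescu_Tulcea (markov_step P x) (\<lambda>_. count_space UNIV)"
proof -
  have tot: "prob_space (point_measure UNIV (\<lambda>y. ennreal (P z y)))" for z
  proof -
    have nonneg: "\<And>y. 0 \<le> P z y" and sum: "(P z has_sum 1) UNIV"
      using assms by (auto simp: stochastic_matrix_def)
    have "(\<integral>\<^sup>+y. ennreal (P z y) \<partial>count_space UNIV) = ennreal (infsum (P z) UNIV)"
      using sum nonneg
      by (metis abs_summable_equivalent has_sum_imp_summable infsetsum_infsum
          nn_integral_conv_infsetsum summable_on_iff_abs_summable_on_real)
    also have "\<dots> = 1" using sum by (simp add: infsumI)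
    finally have "emeasure (point_measure UNIV (\<lambda>y. ennreal (P z y))) UNIV = 1"
      by (simp add: point_measure_def emeasure_density)
    then show ?thesis by (intro prob_spaceI) (simp add: space_point_measure)
  qed
  show ?thesis
  proof (rule Ionescu_Tulcea.intro)
    fix i :: nat
    show "markov_step P x i \<in>
      measurable (PiM {0..<i} (\<lambda>_. count_space UNIV)) (subprob_algebra (count_space UNIV))"
    proof (cases i)
      case 0
      then show ?thesis
        by (auto simp: markov_step_def[abs_def] space_subprob_algebra
            intro!: prob_space_imp_subprob_space prob_space_return)
    next
      case (Suc j)
      have "(\<lambda>\<omega>. \<omega> j) \<in> measurable (PiM {0..<i} (\<lambda>_. count_space UNIV)) (count_space (UNIV::'v set))"
        using Suc by (intro measurable_component_singleton) auto
      moreover have "(\<lambda>z. point_measure UNIV (\<lambda>y. ennreal (P z y))) \<in>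
          measurable (count_space UNIV) (subprob_algebra (count_space UNIV))"
        using tot by (auto simp: space_subprob_algebra sets_point_measure
            intro!: prob_space_imp_subprob_space)
      ultimately have "(\<lambda>\<omega>. point_measure UNIV (\<lambda>y. ennreal (P (\<omega> j) y))) \<in>
          measurable (PiM {0..<i} (\<lambda>_. count_space UNIV)) (subprob_algebra (count_space UNIV))"
        by (rule measurable_compose)
      moreover have "markov_step P x i = (\<lambda>\<omega>. point_measure UNIV (\<lambda>y. ennreal (P (\<omega> j) y)))"
        using Suc by (simp add: markov_step_def fun_eq_iff)
      ultimately show ?thesis by metis
    qed
  next
    fix i :: nat and \<omega> :: "nat \<Rightarrow> 'v"
    show "prob_space (markov_step P x i \<omega>)"
      using tot by (auto simp: markov_step_def intro!: prob_space_return)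
  qed
qed

lemma markov_chain_path_measure:
  fixes P :: "'v::countable \<Rightarrow> 'v \<Rightarrow> real"
  assumes P: "stochastic_matrix P"
  shows "markov_chain (path_measure P x) (\<lambda>n \<omega>. \<omega> n) P x"
proof -
  let ?M = "\<lambda>_::nat. count_space (UNIV::'v set)"
  interpret IT: Ionescu_Tulcea "markov_step P x" ?M
    by (rule Ionescu_Tulcea_markov_step[OF P])
  have pm: "path_measure P x = IT.PF.lim" by (simp add: path_measure_def)
  have nonneg: "\<And>y z. 0 \<le> P y z" using P by (auto simp: stochastic_matrix_def)
  have sets_pm: "sets (path_measure P x) = sets (PiM UNIV ?M)" by (simp add: pm)
  have space_pm: "space (path_measure P x) = UNIV"
    using sets_eq_imp_space_eq[OF sets_pm] by (simp add: space_PiM)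
  interpret prob_space "path_measure P x"
    unfolding pm
    by (rule prob_space_distrD[where f = "\<lambda>\<omega>. restrict \<omega> {}" and N = "PiM {} ?M"])
       (auto simp: IT.distr_lim IT.PF.prob_space_P measurable_cong_sets[OF IT.PF.sets_lim refl]
          intro!: measurable_restrict)
  let ?A = "\<lambda>n w. PiE {0..<n} (\<lambda>i. {w i :: 'v})"
  let ?q = "\<lambda>n w. emeasure (markov_step P x n w) {w n}"
  have A[measurable]: "?A n w \<in> sets (PiM {0..<n} ?M)" for n w
    by (rule sets_PiM_I_finite) auto
  have C: "emeasure (IT.C 0 n (\<lambda>_. undefined)) (?A n w) = (\<Prod>i<n. ?q i w)" for n w
  proof (induction n)
    case 0
    then show ?case by (simp add: PiM_empty)
  next
    case (Suc n)
    have sp: "(\<lambda>_. undefined) \<in> space (PiM {0..<0} ?M)" by (simp add: space_PiM)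
    have "emeasure (IT.C 0 (Suc n) (\<lambda>_. undefined)) (?A (Suc n) w) =
        (\<integral>\<^sup>+\<omega>. emeasure (IT.eP n \<omega>) (?A (Suc n) w) \<partial>IT.C 0 n (\<lambda>_. undefined))"
      using IT.space_C[OF sp, of n] IT.sets_C[OF sp, of n] IT.measurable_eP[of n]
      by (simp, subst emeasure_bind[where N = "PiM {0..<Suc n} ?M"])
         (auto simp: measurable_cong_sets[OF IT.sets_C[OF sp] refl] space_PiM)
    also have "\<dots> = (\<integral>\<^sup>+\<omega>. ?q n w * indicator (?A n w) \<omega> \<partial>IT.C 0 n (\<lambda>_. undefined))"
    proof (rule nn_integral_cong)
      fix \<omega> assume "\<omega> \<in> space (IT.C 0 n (\<lambda>_. undefined))"
      then have \<omega>: "\<omega> \<in> space (PiM {0..<n} ?M)" using IT.space_C[OF sp, of n] by simp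
      have "fun_upd \<omega> n -` ?A (Suc n) w = (if \<omega> \<in> ?A n w then {w n} else {})"
        using \<omega> by (auto simp: PiE_iff space_PiM extensional_def atLeastLessThanSuc split: if_splits)
      moreover have "markov_step P x n \<omega> = markov_step P x n w" if "\<omega> \<in> ?A n w"
        using that by (cases n) (auto simp: markov_step_def PiE_iff)
      ultimately show "emeasure (IT.eP n \<omega>) (?A (Suc n) w) = ?q n w * indicator (?A n w) \<omega>"
        using IT.emeasure_eP[OF \<omega> A] by simp
    qed
    also have "\<dots> = ?q n w * (\<Prod>i<n. ?q i w)"
      using A IT.sets_C[OF sp, of n] Suc by (subst nn_integral_cmult_indicator) auto
    finally show ?case by (simp add: mult.commute)
  qed
  have q0: "?q 0 w = indicator {x} (w 0)" for w
    by (auto simp: markov_step_def indicator_def)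
  have qS: "?q (Suc i) w = ennreal (P (w i) (w (Suc i)))" for i w
    by (simp add: markov_step_def emeasure_point_measure_finite2)
  have cyl: "measure (path_measure P x) {\<omega> \<in> space (path_measure P x). \<forall>i\<le>n. \<omega> i = w i} =
      (if w 0 = x then \<Prod>i<n. P (w i) (w (Suc i)) else 0)" for n w
  proof -
    have "{\<omega> \<in> space (path_measure P x). \<forall>i\<le>n. \<omega> i = w i} =
        IT.PF.emb UNIV {0..<Suc n} (?A (Suc n) w)"
      by (auto simp: space_pm prod_emb_def space_PiM less_Suc_eq_le PiE_iff)
    then have "emeasure (path_measure P x) {\<omega> \<in> space (path_measure P x). \<forall>i\<le>n. \<omega> i = w i} =
        emeasure (IT.CI {0..<Suc n}) (?A (Suc n) w)"
      unfolding pm by (simp only: IT.lim[OF _ A] finite_atLeastLessThan)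
    also have "\<dots> = emeasure (IT.C 0 (Suc n) (\<lambda>_. undefined)) (?A (Suc n) w)"
      by (subst IT.emeasure_CI[OF order_refl A]) simp
    also have "\<dots> = ?q 0 w * (\<Prod>i<n. ?q (Suc i) w)"
      unfolding C by (rule prod.lessThan_Suc_shift)
    also have "\<dots> = ennreal (if w 0 = x then \<Prod>i<n. P (w i) (w (Suc i)) else 0)"
      unfolding q0 qS using nonneg by (simp add: prod_ennreal)
    finally show ?thesis
      using nonneg by (simp add: measure_def prod_nonneg)
  qed
  have "(\<lambda>\<omega>. \<omega> n) \<in> measurable (path_measure P x) (count_space UNIV)" for n
    unfolding measurable_cong_sets[OF sets_pm refl] by (rule measurable_component_singleton) simp
  then show ?thesis
    unfolding markov_chain_def using cyl prob_space_axioms by blast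
qed

end

theory Submission
  imports Defs
begin

text \<open>
  Part (b) is the contrapositive of (a). Let \<open>v\<^sub>n\<close> be the solution of the Dirichlet problem on
  \<open>K n\<close>. Since the real part is a ring homomorphism on bounded elements, \<open>\<rho> \<circ> v\<^sub>n\<close> is harmonic on
  \<open>K n - {a}\<close> for the real chain, and \<open>\<rho>(cap / b(a)) = 1 - (\<Sum>y. \<pi>(a,y) \<rho>(v\<^sub>n y))\<close>. Being
  nonnegative and \<open>1\<close> at \<open>a\<close>, for large \<open>n\<close> it dominates the probability of hitting \<open>a\<close> within any
  given number of steps. If \<open>G(a) < \<infinity>\<close>, then \<open>\<rho>(cap / b(a))\<close> is bounded away from \<open>0\<close>, so the
  probability of ever returning to \<open>a\<close> is less than \<open>1\<close>. With only one vertex, \<open>G(a) = \<infinity>\<close>.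
\<close>

section \<open>The real part as a ring homomorphism\<close>

text \<open>This expresses that \<open>k - r\<close> is infinitesimal without an ordered field containing both
  \<open>\<real>\<close> and the field of \<open>k\<close>.\<close>

definition infinitely_close :: "'k::linordered_field \<Rightarrow> real \<Rightarrow> bool" where
  "infinitely_close k r \<longleftrightarrow>
     (\<forall>e>0. \<exists>q. \<bar>k - of_rat q\<bar> \<le> of_rat e \<and> \<bar>r - of_rat q\<bar> \<le> of_rat e)"

text \<open>Provides the tolerance \<open>d\<close> in the product estimate below. The witness
  divides by \<open>c + 1\<close> because \<open>c\<close> may be \<open>0\<close>.\<close>

lemma rat_mult_le_small:
  fixes c e :: rat
  assumes "0 < e" "0 \<le> c"
  obtains d where "0 < d" "d \<le> 1" "c * d \<le> e"
proof
  let ?d = "min 1 (e / (c + 1))"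
  show "0 < ?d" "?d \<le> 1" using assms by auto
  have "c * ?d \<le> c * (e / (c + 1))" using assms by (intro mult_left_mono) auto
  also have "\<dots> \<le> e" using assms by (simp add: field_simps)
  finally show "c * ?d \<le> e" .
qed

text \<open>Only the rationals lie in both fields, so the order is transferred through rational
  approximants: \<open>q \<le> p + 2 * e\<close> follows in the field of \<open>k\<close>, holds in
  the rationals, and is then read in the reals.\<close>

lemma infinitely_close_mono:
  assumes "infinitely_close k r" "infinitely_close l s" "k \<le> l"
  shows "r \<le> s"
proof (rule ccontr)
  assume "\<not> r \<le> s"
  \<comment> \<open>A quarter of the gap, since four errors of size \<open>e\<close> add up: two in
    each field.\<close>
  then obtain e where e: "0 < real_of_rat e" "real_of_rat e < (r - s) / 4"
    using of_rat_dense[of 0 "(r - s) / 4"] by auto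
  then have "0 < e" by simp
  then obtain q p where q: "\<bar>k - of_rat q\<bar> \<le> of_rat e" "\<bar>r - of_rat q\<bar> \<le> of_rat e"
    and p: "\<bar>l - of_rat p\<bar> \<le> of_rat e" "\<bar>s - of_rat p\<bar> \<le> of_rat e"
    using assms unfolding infinitely_close_def by meson
  have "of_rat q \<le> (of_rat p + of_rat e + of_rat e :: 'a)"
    using q(1) p(1) \<open>k \<le> l\<close> by linarith
  then have "q \<le> p + e + e" by (simp only: of_rat_add[symmetric] of_rat_less_eq)
  then have "real_of_rat q \<le> real_of_rat p + real_of_rat e + real_of_rat e"
    by (simp only: of_rat_add[symmetric] of_rat_less_eq)
  moreover have "r \<le> of_rat q + of_rat e" "of_rat p \<le> s + of_rat e"
    using q(2) p(2) by (simp_all add: abs_le_iff)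
  moreover have "4 * real_of_rat e < r - s" using e(2) by simp
  ultimately show False by linarith
qed

lemma infinitely_close_of_rat: "infinitely_close (of_rat q) (of_rat q)"
  unfolding infinitely_close_def by (auto intro!: exI[of _ q])

lemma infinitely_close_add:
  assumes "infinitely_close k r" "infinitely_close l s"
  shows "infinitely_close (k + l) (r + s)"
  unfolding infinitely_close_def
proof (intro allI impI)
  fix e :: rat assume "0 < e"
  then have "0 < e / 2" by simp
  then obtain q p where q: "\<bar>k - of_rat q\<bar> \<le> of_rat (e / 2)" "\<bar>r - of_rat q\<bar> \<le> of_rat (e / 2)"
    and p: "\<bar>l - of_rat p\<bar> \<le> of_rat (e / 2)" "\<bar>s - of_rat p\<bar> \<le> of_rat (e / 2)"
    using assms unfolding infinitely_close_def by meson
  have "of_rat e = (of_rat (e / 2) + of_rat (e / 2) :: 'a)"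
    "of_rat e = (of_rat (e / 2) + of_rat (e / 2) :: real)"
    by (simp_all only: of_rat_add[symmetric] field_sum_of_halves)
  then show "\<exists>q. \<bar>k + l - of_rat q\<bar> \<le> of_rat e \<and> \<bar>r + s - of_rat q\<bar> \<le> of_rat e"
    using q p by (intro exI[of _ "q + p"]) (simp only: of_rat_add, linarith)
qed

text \<open>Split \<open>k * l - q * p = k * (l - p) + (k - q) * p\<close>, with
  \<open>\<bar>p\<bar> \<le> c + 1\<close> because \<open>d \<le> 1\<close>. The estimate is used
  both in the given field and in the reals.\<close>

lemma abs_mult_diff_le:
  fixes k l :: "'k::linordered_field"
  assumes "\<bar>k - q\<bar> \<le> d" "\<bar>l - p\<bar> \<le> d" "\<bar>k\<bar> \<le> c" "\<bar>l\<bar> \<le> c" "d \<le> 1"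
  shows "\<bar>k * l - q * p\<bar> \<le> (2 * c + 1) * d"
proof -
  have d: "0 \<le> d" using assms(1) by linarith
  have p: "\<bar>p\<bar> \<le> c + 1" using assms by linarith
  have "k * l - q * p = k * (l - p) + (k - q) * p" by (simp add: algebra_simps)
  then have "\<bar>k * l - q * p\<bar> \<le> \<bar>k\<bar> * \<bar>l - p\<bar> + \<bar>k - q\<bar> * \<bar>p\<bar>"
    by (metis abs_mult abs_triangle_ineq)
  also have "\<dots> \<le> c * d + d * (c + 1)"
    using assms p d by (intro add_mono mult_mono) auto
  finally show ?thesis by (simp add: algebra_simps)
qed

text \<open>An approximation with tolerance \<open>1\<close> yields the bound. It is rational so
  that one constant serves both fields.\<close>

lemma infinitely_close_bound:
  assumes "infinitely_close k r"
  obtains c where "0 \<le> c" "\<bar>k\<bar> \<le> of_rat c" "\<bar>r\<bar> \<le> of_rat c"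
proof -
  have "(0::rat) < 1" by simp
  then obtain q where "\<bar>k - of_rat q\<bar> \<le> of_rat 1" "\<bar>r - of_rat q\<bar> \<le> of_rat 1"
    using assms unfolding infinitely_close_def by meson
  then have "\<bar>k\<bar> \<le> \<bar>of_rat q\<bar> + of_rat 1" "\<bar>r\<bar> \<le> \<bar>of_rat q\<bar> + of_rat 1" by linarith+
  then have "\<bar>k\<bar> \<le> of_rat (\<bar>q\<bar> + 1)" "\<bar>r\<bar> \<le> of_rat (\<bar>q\<bar> + 1)"
    by (simp_all add: of_rat_add abs_if of_rat_minus split: if_splits)
  then show thesis using that[of "\<bar>q\<bar> + 1"] by simp
qed

lemma infinitely_close_mult:
  assumes "infinitely_close k r" "infinitely_close l s"
  shows "infinitely_close (k * l) (r * s)"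
  unfolding infinitely_close_def
proof (intro allI impI)
  fix e :: rat assume "0 < e"
  obtain c1 where c1: "0 \<le> c1" "\<bar>k\<bar> \<le> of_rat c1" "\<bar>r\<bar> \<le> of_rat c1"
    using infinitely_close_bound[OF assms(1)] .
  obtain c2 where c2: "0 \<le> c2" "\<bar>l\<bar> \<le> of_rat c2" "\<bar>s\<bar> \<le> of_rat c2"
    using infinitely_close_bound[OF assms(2)] .
  define c where "c = max c1 c2"
  have "of_rat c1 \<le> (of_rat c :: 'a)" "of_rat c2 \<le> (of_rat c :: 'a)"
    "real_of_rat c1 \<le> of_rat c" "real_of_rat c2 \<le> of_rat c"
    by (simp_all add: of_rat_less_eq c_def)
  then have c: "\<bar>k\<bar> \<le> of_rat c" "\<bar>r\<bar> \<le> of_rat c" "\<bar>l\<bar> \<le> of_rat c" "\<bar>s\<bar> \<le> of_rat c"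
    using c1 c2 by linarith+
  have "0 \<le> 2 * c + 1" using c1 by (simp add: c_def)
  then obtain d where d: "0 < d" "d \<le> 1" "(2 * c + 1) * d \<le> e"
    using rat_mult_le_small[OF \<open>0 < e\<close>] by blast
  obtain q p where q: "\<bar>k - of_rat q\<bar> \<le> of_rat d" "\<bar>r - of_rat q\<bar> \<le> of_rat d"
    and p: "\<bar>l - of_rat p\<bar> \<le> of_rat d" "\<bar>s - of_rat p\<bar> \<le> of_rat d"
    using assms d(1) unfolding infinitely_close_def by meson
  have d1: "of_rat d \<le> (1::'a)" "real_of_rat d \<le> 1" using d(2) by simp_all
  have "of_rat ((2 * c + 1) * d) \<le> (of_rat e :: 'a)" "real_of_rat ((2 * c + 1) * d) \<le> of_rat e"
    using d(3) by (simp_all only: of_rat_less_eq)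
  then have "(2 * of_rat c + 1) * of_rat d \<le> (of_rat e :: 'a)"
    "(2 * of_rat c + 1) * of_rat d \<le> (of_rat e :: real)"
    by (simp_all add: of_rat_mult of_rat_add)
  then show "\<exists>q. \<bar>k * l - of_rat q\<bar> \<le> of_rat e \<and> \<bar>r * s - of_rat q\<bar> \<le> of_rat e"
    using abs_mult_diff_le[OF q(1) p(1) c(1,3) d1(1)] abs_mult_diff_le[OF q(2) p(2) c(2,4) d1(2)]
    by (intro exI[of _ "q * p"]) (simp add: of_rat_mult)
qed

lemma infinitely_close_sum:
  assumes "\<And>i. i \<in> A \<Longrightarrow> infinitely_close (f i) (g i)"
  shows "infinitely_close (sum f A) (sum g A)"
  using assms
proof (induction A rule: infinite_finite_induct)
  case (insert i A)
  then show ?case by (simp add: infinitely_close_add)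
qed (use infinitely_close_of_rat[of 0] in simp_all)

section \<open>Existence and uniqueness of the real part\<close>

text \<open>The bounds \<open>-c\<close> and \<open>c\<close> make the cut nonempty and bounded, so
  its supremum is meaningful. A rational \<open>q\<close> of the cut within \<open>e\<close> of the
  supremum approximates both numbers: \<open>q + e\<close> lies beyond the supremum, hence above
  \<open>k\<close>.\<close>

lemma infinitely_close_real_part:
  fixes k :: "'k::linordered_field"
  assumes "\<bar>k\<bar> \<le> of_rat c"
  shows "infinitely_close k (real_part k)"
proof -
  define S where "S = {real_of_rat q |q. of_rat q \<le> k}"
  have up: "real_of_rat q \<le> real_of_rat p" if "of_rat q \<le> k" "k \<le> of_rat p" for q p
    using order_trans[OF that] by (simp add: of_rat_less_eq)
  have k: "of_rat (- c) \<le> k" "k \<le> of_rat c" using assms by (auto simp: of_rat_minus)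
  have ne: "S \<noteq> {}" using k(1) unfolding S_def by blast
  have bdd: "bdd_above S" using up[OF _ k(2)] unfolding S_def by (auto intro!: bdd_aboveI)
  have le: "Sup S \<le> of_rat p" if "k \<le> of_rat p" for p
    using up[OF _ that] ne by (intro cSup_least) (auto simp: S_def)
  have ge: "of_rat q \<le> Sup S" if "of_rat q \<le> k" for q
    using that by (intro cSup_upper bdd) (auto simp: S_def)
  show ?thesis unfolding infinitely_close_def real_part_def S_def[symmetric]
  proof (intro allI impI)
    fix e :: rat assume "0 < e"
    then have "0 < real_of_rat e" by simp
    then obtain s where "s \<in> S" "Sup S - of_rat e < s"
      using less_cSup_iff[OF ne bdd, of "Sup S - of_rat e"] by auto
    then obtain q where q: "of_rat q \<le> k" "Sup S - of_rat e < of_rat q"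
      unfolding S_def by auto
    have "\<not> of_rat (q + e) \<le> k"
      using ge[of "q + e"] q(2) by (auto simp: of_rat_add)
    then have "k \<le> of_rat q + of_rat e" by (simp add: of_rat_add)
    then show "\<exists>q. \<bar>k - of_rat q\<bar> \<le> of_rat e \<and> \<bar>Sup S - of_rat q\<bar> \<le> of_rat e"
      using q ge[OF q(1)] by (intro exI[of _ q]) (auto simp: abs_le_iff algebra_simps)
  qed
qed

text \<open>Monotonicity with \<open>k\<close> on both sides gives both inequalities. Real parts can
  thus be computed by the closure rules for \<open>infinitely_close\<close>.\<close>

lemma real_part_eqI:
  assumes "infinitely_close k r"
  shows "real_part k = r"
proof -
  obtain c where "\<bar>k\<bar> \<le> of_rat c" using infinitely_close_bound[OF assms] .
  from infinitely_close_real_part[OF this] show ?thesis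
    using infinitely_close_mono[OF _ assms] infinitely_close_mono[OF assms] by (meson antisym order_refl)
qed

lemma infinitely_close_real_part_unit:
  fixes k :: "'k::linordered_field"
  assumes "0 \<le> k" "k \<le> 1"
  shows "infinitely_close k (real_part k)" "0 \<le> real_part k" "real_part k \<le> 1"
proof -
  show *: "infinitely_close k (real_part k)"
    using assms by (intro infinitely_close_real_part[of k 1]) simp
  show "0 \<le> real_part k"
    using infinitely_close_mono[OF infinitely_close_of_rat[of 0] *] assms by simp
  show "real_part k \<le> 1"
    using infinitely_close_mono[OF * infinitely_close_of_rat[of 1]] assms by simp
qed

lemma real_part_0: "real_part 0 = 0"
  using real_part_eqI[OF infinitely_close_of_rat[of 0]] by simp

lemma real_part_1: "real_part 1 = 1"
  using real_part_eqI[OF infinitely_close_of_rat[of 1]] by simp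

section \<open>Homogeneous linear systems\<close>

text \<open>Gaussian elimination: an equation that vanishes on \<open>U\<close> is dropped; any
  other is solved for a pivot \<open>z\<close> and substituted into the rest, which removes one
  equation and one unknown.\<close>

lemma homogeneous_system_nontrivial_solution:
  fixes A :: "'e \<Rightarrow> 'u \<Rightarrow> 'k::field"
  assumes "finite E" "finite U" "card E < card U"
  shows "\<exists>u. (\<exists>y\<in>U. u y \<noteq> 0) \<and> (\<forall>x\<in>E. (\<Sum>y\<in>U. A x y * u y) = 0)"
  using assms
proof (induction E arbitrary: U A rule: finite_induct)
  case empty
  then obtain y where "y \<in> U" by fastforce
  then show ?case by (intro exI[of _ "\<lambda>_. 1"]) auto
next
  case (insert e E)
  show ?case
  proof (cases "\<forall>y\<in>U. A e y = 0")
    case True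
    have "card E < card U" using insert by simp
    then obtain u where "\<exists>y\<in>U. u y \<noteq> 0" "\<forall>x\<in>E. (\<Sum>y\<in>U. A x y * u y) = 0"
      using insert.IH[OF insert.prems(1), of A] by blast
    then show ?thesis using True by (intro exI[of _ u]) auto
  next
    case False
    then obtain z where z: "z \<in> U" "A e z \<noteq> 0" by blast
    let ?U = "U - {z}"
    have "finite ?U" "card E < card ?U" using insert z by auto
    then obtain u where u: "\<exists>y\<in>?U. u y \<noteq> 0"
      "\<forall>x\<in>E. (\<Sum>y\<in>?U. (A x y - A x z * A e y / A e z) * u y) = 0"
      using insert.IH[of ?U "\<lambda>x y. A x y - A x z * A e y / A e z"] by blast
    \<comment> \<open>The value at the pivot that equation \<open>e\<close> forces.\<close>
    define t where "t = - (\<Sum>y\<in>?U. A e y * u y) / A e z"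
    have S: "(\<Sum>y\<in>U. A x y * (u(z := t)) y) = A x z * t + (\<Sum>y\<in>?U. A x y * u y)" for x
      using z insert.prems(1) by (simp add: sum.remove[of U z])
    have "(\<Sum>y\<in>?U. (A x y - A x z * A e y / A e z) * u y)
        = (\<Sum>y\<in>?U. A x y * u y) - A x z / A e z * (\<Sum>y\<in>?U. A e y * u y)" for x
      by (simp add: sum_distrib_left sum_subtractf algebra_simps)
    then have E: "(\<Sum>y\<in>U. A x y * (u(z := t)) y) = 0" if "x \<in> E" for x
      using u(2) that z(2) unfolding S by (simp add: t_def)
    have "(\<Sum>y\<in>U. A e y * (u(z := t)) y) = 0" unfolding S using z by (simp add: t_def)
    then show ?thesis using u(1) E by (intro exI[of _ "u(z := t)"]) auto
  qed
qed

section \<open>The Dirichlet problem on finite sets\<close>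

lemma vertex_weight_pos:
  assumes b: "weighted_graph b" "locally_finite_graph b" and "0 < b x y"
  shows "0 < vertex_weight b x"
  unfolding vertex_weight_def
  using assms by (intro sum_pos) (auto simp: neighbors_def locally_finite_graph_def)

text \<open>The first edge of a path from \<open>x\<close> to \<open>y\<close> gives
  \<open>x\<close> a neighbor.\<close>

lemma vertex_weight_pos_connected:
  assumes b: "weighted_graph b" "locally_finite_graph b"
    and K: "connected_in b K" "x \<in> K" "y \<in> K" "x \<noteq> y"
  shows "0 < vertex_weight b x"
proof -
  have "(\<lambda>u w. u \<in> K \<and> w \<in> K \<and> 0 < b u w)\<^sup>*\<^sup>* x y" using K by (simp add: connected_in_def)
  then show ?thesis
    using \<open>x \<noteq> y\<close> vertex_weight_pos[OF b] by (cases rule: converse_rtranclpE) auto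
qed

lemma laplacian_diff:
  "laplacian b (\<lambda>x. f x - g x) x = laplacian b f x - laplacian b g x"
proof -
  have "b x y * (f x - g x - (f y - g y)) = b x y * (f x - f y) - b x y * (g x - g y)" for y
    by (simp add: algebra_simps)
  then show ?thesis by (simp add: laplacian_def sum_subtractf right_diff_distrib diff_divide_distrib)
qed

lemma laplacian_uminus: "laplacian b (\<lambda>x. - f x) x = - laplacian b f x"
  using laplacian_diff[of b "\<lambda>_. 0" f x] by (simp add: laplacian_def)

lemma laplacian_const: "laplacian b (\<lambda>_. c) x = 0"
  by (simp add: laplacian_def)

text \<open>The weights \<open>b x y\<close> may be infinitely large or infinitesimal, but the
  quotients here lie between \<open>0\<close> and \<open>1\<close>, so real parts can be taken term
  by term.\<close>

lemma laplacian_eq_average: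
  fixes b :: "'v \<Rightarrow> 'v \<Rightarrow> 'k::linordered_field"
  assumes "vertex_weight b x \<noteq> 0"
  shows "laplacian b f x = f x - (\<Sum>y\<in>neighbors b x. b x y / vertex_weight b x * f y)"
proof -
  have "(\<Sum>y\<in>neighbors b x. b x y * (f x - f y))
      = vertex_weight b x * f x - (\<Sum>y\<in>neighbors b x. b x y * f y)"
    by (simp add: vertex_weight_def sum_distrib_right sum_subtractf right_diff_distrib)
  then show ?thesis
    using assms by (simp add: laplacian_def right_diff_distrib diff_divide_distrib sum_divide_distrib)
qed

section \<open>Maximum principle\<close>

text \<open>At a maximum all summands of the Laplacian are nonnegative; as their sum is
  \<open>0\<close>, each of them vanishes.\<close>

lemma max_attained_at_neighbor:
  fixes b :: "'v \<Rightarrow> 'v \<Rightarrow> 'k::linordered_field"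
  assumes b: "weighted_graph b" "locally_finite_graph b"
    and "laplacian b f x = 0" and max: "\<And>y. f y \<le> f x" and "0 < b x z"
  shows "f z = f x"
proof (rule ccontr)
  assume "f z \<noteq> f x"
  then have "0 < b x z * (f x - f z)" using max[of z] \<open>0 < b x z\<close> by simp
  moreover have "finite (neighbors b x)" "z \<in> neighbors b x"
    using b \<open>0 < b x z\<close> by (auto simp: locally_finite_graph_def neighbors_def)
  ultimately have "0 < (\<Sum>y\<in>neighbors b x. b x y * (f x - f y))"
    using max by (intro sum_pos2[of _ z]) (auto simp: neighbors_def)
  then show False
    using assms(3) vertex_weight_pos[OF b \<open>0 < b x z\<close>] by (simp add: laplacian_def)
qed

text \<open>A positive maximum over the finite set \<open>K\<close> would spread along a path inside
  \<open>K\<close> until it reaches \<open>a\<close>, where \<open>f\<close> is not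
  positive.\<close>

lemma maximum_principle:
  fixes b :: "'v \<Rightarrow> 'v \<Rightarrow> 'k::linordered_field"
  assumes b: "weighted_graph b" "locally_finite_graph b"
    and K: "finite K" "connected_in b K" "a \<in> K"
    and f: "\<forall>x\<in>K - {a}. laplacian b f x = 0" "f a \<le> 0" "\<forall>x. x \<notin> K \<longrightarrow> f x \<le> 0"
  shows "f x \<le> 0"
proof (rule ccontr)
  assume neg: "\<not> f x \<le> 0"
  then have "x \<in> K" using f by blast
  define m where "m = Max (f ` K)"
  have "f x \<le> m" using \<open>x \<in> K\<close> K(1) by (simp add: m_def)
  with neg have "0 < m" by simp
  \<comment> \<open>The bound must be global, since neighbors of points of \<open>K\<close> may lie
    outside \<open>K\<close>; there \<open>f\<close> is at most \<open>0\<close>, hence below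
    \<open>m\<close>.\<close>
  have max: "f y \<le> m" for y
    using K(1) f(3) \<open>0 < m\<close> by (cases "y \<in> K") (auto simp: m_def intro: order_trans[of _ 0])
  have "m \<in> f ` K" unfolding m_def using K(1) \<open>x \<in> K\<close> by (intro Max_in) auto
  then obtain z where z: "z \<in> K" "f z = m" by auto
  have "(\<lambda>u w. u \<in> K \<and> w \<in> K \<and> 0 < b u w)\<^sup>*\<^sup>* z a" using z K by (simp add: connected_in_def)
  then have "f a = m"
  proof (induction rule: rtranclp_induct)
    case (step u w)
    show ?case
    proof (cases "u = a")
      case True
      then show ?thesis using step f(2) \<open>0 < m\<close> by simp
    next
      case False
      then show ?thesis
        using max_attained_at_neighbor[OF b, of f u w] step f(1) max by auto
    qed
  qed (use z in simp)
  then show False using f(2) \<open>0 < m\<close> by simp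
qed

section \<open>Existence, uniqueness and bounds for the Dirichlet solution\<close>

text \<open>The condition under \<open>THE\<close> in \<open>dirichlet_solution\<close>, named so
  that existence and uniqueness can be stated separately.\<close>

definition is_dirichlet_solution ::
    "('v \<Rightarrow> 'v \<Rightarrow> 'k::linordered_field) \<Rightarrow> 'v set \<Rightarrow> 'v \<Rightarrow> ('v \<Rightarrow> 'k) \<Rightarrow> bool" where
  "is_dirichlet_solution b K a v \<longleftrightarrow>
     (\<forall>x\<in>K - {a}. laplacian b v x = 0) \<and> v a = 1 \<and> (\<forall>x. x \<notin> K \<longrightarrow> v x = 0)"

lemma dirichlet_solution_unique:
  assumes b: "weighted_graph b" "locally_finite_graph b"
    and K: "finite K" "connected_in b K" "a \<in> K"
    and v: "is_dirichlet_solution b K a v" and w: "is_dirichlet_solution b K a w"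
  shows "v = w"
proof
  fix x
  have "v x - w x \<le> 0"
    by (rule maximum_principle[OF b K, of "\<lambda>x. v x - w x"])
      (use v w in \<open>auto simp: is_dirichlet_solution_def laplacian_diff\<close>)
  moreover have "w x - v x \<le> 0"
    by (rule maximum_principle[OF b K, of "\<lambda>x. w x - v x"])
      (use v w in \<open>auto simp: is_dirichlet_solution_def laplacian_diff\<close>)
  ultimately show "v x = w x" by simp
qed

text \<open>There is one linear equation for each vertex of \<open>K - {a}\<close> and one unknown for each vertex of
  \<open>K\<close>, so a nonzero solution exists; by the maximum principle it does not vanish at \<open>a\<close>.\<close>

lemma dirichlet_solution_exists:
  fixes b :: "'v \<Rightarrow> 'v \<Rightarrow> 'k::linordered_field"
  assumes b: "weighted_graph b" "locally_finite_graph b"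
    and K: "finite K" "connected_in b K" "a \<in> K"
  shows "\<exists>v. is_dirichlet_solution b K a v"
proof -
  \<comment> \<open>Row \<open>x\<close> is the Laplacian at \<open>x\<close>, multiplied by
    \<open>vertex_weight b x\<close>, for functions that vanish outside \<open>K\<close>.\<close>
  let ?A = "\<lambda>x y. (if y = x then vertex_weight b x else 0) - b x y"
  have "card (K - {a}) < card K" using K by (intro psubset_card_mono) auto
  then obtain u where nz: "\<exists>y\<in>K. u y \<noteq> 0" and u: "\<forall>x\<in>K - {a}. (\<Sum>y\<in>K. ?A x y * u y) = 0"
    using homogeneous_system_nontrivial_solution[of "K - {a}" K ?A] K by auto
  define v where "v x = (if x \<in> K then u x else 0)" for x
  have harm: "laplacian b v x = 0" if "x \<in> K - {a}" for x
  proof -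
    have fin: "finite (neighbors b x)" using b by (simp add: locally_finite_graph_def)
    have nb: "b x y = 0" if "y \<notin> neighbors b x" for y
      using that b by (auto simp: neighbors_def weighted_graph_def order.order_iff_strict)
    \<comment> \<open>Terms outside \<open>neighbors b x\<close> vanish through \<open>b\<close>,
      terms outside \<open>K\<close> through \<open>v\<close>.\<close>
    have "(\<Sum>y\<in>neighbors b x. b x y * v y) = (\<Sum>y\<in>K. b x y * u y)"
      using fin K(1) nb
      by (intro sum.mono_neutral_cong) (auto simp: v_def)
    moreover have "(\<Sum>y\<in>K. ?A x y * u y)
        = vertex_weight b x * u x - (\<Sum>y\<in>K. b x y * u y)"
    proof -
      have "(\<Sum>y\<in>K. ?A x y * u y)
          = (\<Sum>y\<in>K. (if y = x then vertex_weight b x * u y else 0) - b x y * u y)"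
        by (intro sum.cong) (auto simp: left_diff_distrib)
      then show ?thesis using that K(1) by (simp add: sum_subtractf)
    qed
    ultimately have "(\<Sum>y\<in>neighbors b x. b x y * (v x - v y)) = 0"
      using u that by (simp add: right_diff_distrib sum_subtractf vertex_weight_def
          sum_distrib_right v_def)
    then show ?thesis by (simp add: laplacian_def)
  qed
  have "v a \<noteq> 0"
  proof
    assume "v a = 0"
    have out: "v x = 0" if "x \<notin> K" for x using that by (simp add: v_def)
    have "v x \<le> 0" "- v x \<le> 0" for x
      using harm out \<open>v a = 0\<close> maximum_principle[OF b K, of v x]
        maximum_principle[OF b K, of "\<lambda>x. - v x" x] by (auto simp: laplacian_uminus)
    then have "v x = 0" for x by (simp add: order_antisym)
    moreover obtain y where "y \<in> K" "u y \<noteq> 0" using nz by blast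
    ultimately show False by (metis v_def)
  qed
  have "laplacian b (\<lambda>x. v x / v a) x = laplacian b v x / v a" for x
    by (simp add: laplacian_def sum_divide_distrib diff_divide_distrib right_diff_distrib
        mult.commute)
  then have "is_dirichlet_solution b K a (\<lambda>x. v x / v a)"
    using harm \<open>v a \<noteq> 0\<close> by (auto simp: is_dirichlet_solution_def v_def)
  then show ?thesis by blast
qed

lemma is_dirichlet_solution_dirichlet_solution:
  assumes b: "weighted_graph b" "locally_finite_graph b"
    and K: "finite K" "connected_in b K" "a \<in> K"
  shows "is_dirichlet_solution b K a (dirichlet_solution b K a)"
proof -
  have "\<exists>!v. is_dirichlet_solution b K a v"
    using dirichlet_solution_exists[OF b K] dirichlet_solution_unique[OF b K] by blast
  from theI'[OF this] show ?thesis
    by (simp add: dirichlet_solution_def is_dirichlet_solution_def)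
qed

text \<open>The maximum principle for \<open>- v\<close> and for \<open>v - 1\<close>. These bounds
  are what makes the real part of \<open>v\<close> meaningful.\<close>

lemma is_dirichlet_solution_bounds:
  assumes b: "weighted_graph b" "locally_finite_graph b"
    and K: "finite K" "connected_in b K" "a \<in> K"
    and v: "is_dirichlet_solution b K a v"
  shows "0 \<le> v x" "v x \<le> 1"
proof -
  have "- v x \<le> 0"
    by (rule maximum_principle[OF b K, of "\<lambda>x. - v x"])
      (use v in \<open>auto simp: is_dirichlet_solution_def laplacian_uminus\<close>)
  moreover have "v x - 1 \<le> 0"
    by (rule maximum_principle[OF b K, of "\<lambda>x. v x - 1"])
      (use v in \<open>auto simp: is_dirichlet_solution_def laplacian_diff laplacian_const\<close>)
  ultimately show "0 \<le> v x" "v x \<le> 1" by simp_all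
qed

section \<open>The real transition matrix\<close>

text \<open>The converse fails: a neighbor whose transition quotient is infinitesimal also gets the
  value \<open>0\<close>, so the support of a row can be smaller than
  \<open>neighbors b x\<close>.\<close>

lemma real_transition_support:
  assumes "weighted_graph b"
  shows "y \<notin> neighbors b x \<Longrightarrow> real_transition b x y = 0"
proof -
  assume "y \<notin> neighbors b x"
  then have "b x y = 0" using assms by (auto simp: neighbors_def weighted_graph_def order.order_iff_strict)
  then show ?thesis by (simp add: real_transition_def real_part_0)
qed

lemma infinitely_close_real_transition:
  fixes b :: "'v \<Rightarrow> 'v \<Rightarrow> 'k::linordered_field"
  assumes b: "weighted_graph b" "locally_finite_graph b"
  shows "infinitely_close (b x y / vertex_weight b x) (real_transition b x y)"
    and "0 \<le> real_transition b x y"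
proof -
  have nonneg: "0 \<le> b x z" for z using b by (simp add: weighted_graph_def)
  have fin: "finite (neighbors b x)" using b by (simp add: locally_finite_graph_def)
  have "b x y \<le> vertex_weight b x"
  proof (cases "y \<in> neighbors b x")
    case True
    then show ?thesis unfolding vertex_weight_def
      using fin nonneg by (intro member_le_sum) auto
  next
    case False
    then have "b x y = 0" using nonneg[of y] by (auto simp: neighbors_def)
    then show ?thesis using nonneg by (simp add: vertex_weight_def sum_nonneg)
  qed
  moreover have "0 \<le> vertex_weight b x" using nonneg by (simp add: vertex_weight_def sum_nonneg)
  ultimately have "0 \<le> b x y / vertex_weight b x" "b x y / vertex_weight b x \<le> 1"
    using nonneg[of y] by (auto simp: divide_le_eq_1)
  note * = infinitely_close_real_part_unit[OF this]
  show "infinitely_close (b x y / vertex_weight b x) (real_transition b x y)"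
    and "0 \<le> real_transition b x y"
    using * by (simp_all add: real_transition_def)
qed

text \<open>The real part commutes with finite sums, and the quotients over the finitely many
  neighbors add up to \<open>1\<close>.\<close>

lemma stochastic_matrix_real_transition:
  fixes b :: "'v \<Rightarrow> 'v \<Rightarrow> 'k::linordered_field"
  assumes b: "weighted_graph b" "locally_finite_graph b" and pos: "\<And>x. 0 < vertex_weight b x"
  shows "stochastic_matrix (real_transition b)"
proof -
  have "(real_transition b x has_sum 1) UNIV" for x
  proof -
    have fin: "finite (neighbors b x)" using b by (simp add: locally_finite_graph_def)
    have "(\<Sum>y\<in>neighbors b x. b x y / vertex_weight b x) = 1"
      using pos[of x] by (simp add: sum_divide_distrib[symmetric] vertex_weight_def[symmetric])
    moreover have "infinitely_close (\<Sum>y\<in>neighbors b x. b x y / vertex_weight b x)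
        (\<Sum>y\<in>neighbors b x. real_transition b x y)"
      by (intro infinitely_close_sum infinitely_close_real_transition(1)[OF b])
    ultimately have "infinitely_close (1 :: 'k) (\<Sum>y\<in>neighbors b x. real_transition b x y)"
      by simp
    then have "real_part (1 :: 'k) = (\<Sum>y\<in>neighbors b x. real_transition b x y)"
      by (rule real_part_eqI)
    then show ?thesis
      using fin real_transition_support[OF b(1)] real_part_1[where ?'a = 'k]
      by (intro has_sum_finite_neutralI[of "neighbors b x"]) auto
  qed
  then show ?thesis using infinitely_close_real_transition(2)[OF b] by (simp add: stochastic_matrix_def)
qed

lemma real_part_laplacian:
  fixes b :: "'v \<Rightarrow> 'v \<Rightarrow> 'k::linordered_field"
  assumes b: "weighted_graph b" "locally_finite_graph b" and pos: "0 < vertex_weight b x"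
    and v: "\<And>y. 0 \<le> v y" "\<And>y. v y \<le> 1"
  shows "real_part (laplacian b v x)
    = real_part (v x) - (\<Sum>y\<in>neighbors b x. real_transition b x y * real_part (v y))"
proof -
  let ?s = "\<Sum>y\<in>neighbors b x. b x y / vertex_weight b x * v y"
  let ?r = "\<Sum>y\<in>neighbors b x. real_transition b x y * real_part (v y)"
  note close = infinitely_close_real_part_unit(1)[OF v]
  have "infinitely_close ?s ?r"
    by (intro infinitely_close_sum infinitely_close_mult infinitely_close_real_transition(1)[OF b] close)
  \<comment> \<open>Subtraction is written as addition of a multiple by the rational
    \<open>-1\<close>, so that the closure rules apply.\<close>
  then have "infinitely_close (v x + of_rat (- 1) * ?s) (real_part (v x) + of_rat (- 1) * ?r)"
    by (intro infinitely_close_add infinitely_close_mult infinitely_close_of_rat close)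
  then show ?thesis
    using pos by (intro real_part_eqI) (simp add: laplacian_eq_average of_rat_minus)
qed

section \<open>Hitting probabilities\<close>

text \<open>Infinite rows of \<open>P\<close> would give the junk value \<open>0\<close>.\<close>

primrec hitting_prob :: "('v \<Rightarrow> 'v \<Rightarrow> real) \<Rightarrow> 'v \<Rightarrow> nat \<Rightarrow> 'v \<Rightarrow> real" where
  "hitting_prob P a 0 x = (if x = a then 1 else 0)"
| "hitting_prob P a (Suc n) x =
     (if x = a then 1 else \<Sum>y | P x y \<noteq> 0. P x y * hitting_prob P a n y)"

text \<open>First-step analysis: the cylinder up to time \<open>m\<close> is split by the state at
  time \<open>Suc m\<close>. The bound \<open>h\<close> is left abstract, so the lemma serves both
  the induction for hitting \<open>a\<close> and the return to \<open>a\<close>, where the start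
  itself must not count as a visit.\<close>

lemma cylinder_return_le:
  fixes P :: "'v::countable \<Rightarrow> 'v \<Rightarrow> real" and X :: "nat \<Rightarrow> 'w \<Rightarrow> 'v"
  assumes M: "markov_chain M X P x0" and P: "\<And>x y. 0 \<le> P x y" "\<And>x. finite {y. P x y \<noteq> 0}"
    and hit: "\<And>w. measure M {\<omega> \<in> space M. (\<forall>i\<le>Suc m. X i \<omega> = w i) \<and> (\<exists>j\<in>{Suc m..Suc m + n}. X j \<omega> = a)}
        \<le> measure M {\<omega> \<in> space M. \<forall>i\<le>Suc m. X i \<omega> = w i} * h (w (Suc m))"
  shows "measure M {\<omega> \<in> space M. (\<forall>i\<le>m. X i \<omega> = w i) \<and> (\<exists>j\<in>{Suc m..Suc m + n}. X j \<omega> = a)}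
    \<le> measure M {\<omega> \<in> space M. \<forall>i\<le>m. X i \<omega> = w i} * (\<Sum>y | P (w m) y \<noteq> 0. P (w m) y * h y)"
proof -
  interpret prob_space M using M by (simp add: markov_chain_def)
  have [measurable]: "X i \<in> measurable M (count_space UNIV)" for i
    using M by (simp add: markov_chain_def)
  let ?C = "\<lambda>m w. {\<omega> \<in> space M. \<forall>i\<le>m. X i \<omega> = w i}"
  let ?H = "{\<omega> \<in> space M. \<exists>j\<in>{Suc m..Suc m + n}. X j \<omega> = a}"
  let ?w = "\<lambda>y. w(Suc m := y)"
  let ?F = "{y. P (w m) y \<noteq> 0}"
  have C: "measure M (?C (Suc m) (?w y)) = measure M (?C m w) * P (w m) y" for y
  proof -
    have "(\<Prod>i<m. P (?w y i) (?w y (Suc i))) = (\<Prod>i<m. P (w i) (w (Suc i)))"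
      by (intro prod.cong) auto
    then show ?thesis using M by (simp add: markov_chain_def)
  qed
  \<comment> \<open>Successors outside the finite support form a countable union of null
    cylinders.\<close>
  have null: "(\<Union>y\<in>-?F. ?C (Suc m) (?w y)) \<in> null_sets M"
  proof (intro null_sets_UN')
    fix y assume "y \<in> -?F"
    then have "measure M (?C (Suc m) (?w y)) = 0" by (simp only: C) simp
    then show "?C (Suc m) (?w y) \<in> null_sets M"
      by (intro null_setsI) (simp_all only: emeasure_eq_measure ennreal_0, measurable)
  qed auto
  have "?C m w \<inter> ?H \<subseteq> (\<Union>y\<in>?F. ?C (Suc m) (?w y) \<inter> ?H) \<union> (\<Union>y\<in>-?F. ?C (Suc m) (?w y))"
  proof
    fix \<omega> assume \<omega>: "\<omega> \<in> ?C m w \<inter> ?H"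
    then have "\<omega> \<in> ?C (Suc m) (?w (X (Suc m) \<omega>))" by (auto simp: le_Suc_eq)
    with \<omega> show "\<omega> \<in> (\<Union>y\<in>?F. ?C (Suc m) (?w y) \<inter> ?H) \<union> (\<Union>y\<in>-?F. ?C (Suc m) (?w y))" by blast
  qed
  then have "measure M (?C m w \<inter> ?H)
      \<le> measure M ((\<Union>y\<in>?F. ?C (Suc m) (?w y) \<inter> ?H) \<union> (\<Union>y\<in>-?F. ?C (Suc m) (?w y)))"
    using P(2) null by (intro finite_measure_mono) (auto intro!: sets.Un sets.finite_UN)
  also have "\<dots> = measure M (\<Union>y\<in>?F. ?C (Suc m) (?w y) \<inter> ?H)"
    using P(2) null by (intro measure_Un_null_set) (auto intro!: sets.finite_UN)
  also have "\<dots> \<le> (\<Sum>y\<in>?F. measure M (?C (Suc m) (?w y) \<inter> ?H))"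
    using P(2) by (intro measure_UNION_le) auto
  also have "\<dots> \<le> (\<Sum>y\<in>?F. measure M (?C (Suc m) (?w y)) * h y)"
  proof (intro sum_mono)
    fix y
    have "?C (Suc m) (?w y) \<inter> ?H
        = {\<omega> \<in> space M. (\<forall>i\<le>Suc m. X i \<omega> = ?w y i) \<and> (\<exists>j\<in>{Suc m..Suc m + n}. X j \<omega> = a)}" by blast
    then show "measure M (?C (Suc m) (?w y) \<inter> ?H) \<le> measure M (?C (Suc m) (?w y)) * h y"
      using hit[of "?w y"] by simp
  qed
  also have "\<dots> = measure M (?C m w) * (\<Sum>y\<in>?F. P (w m) y * h y)"
    unfolding C by (simp add: sum_distrib_left mult.assoc)
  also have "?C m w \<inter> ?H
      = {\<omega> \<in> space M. (\<forall>i\<le>m. X i \<omega> = w i) \<and> (\<exists>j\<in>{Suc m..Suc m + n}. X j \<omega> = a)}" by blast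
  finally show ?thesis .
qed

text \<open>Induction on \<open>n\<close>. If \<open>w m = a\<close>, the factor
  \<open>hitting_prob\<close> is \<open>1\<close>; otherwise time \<open>m\<close> drops out of the
  window and one step is analyzed. The product form covers null cylinders without conditional
  probabilities.\<close>

lemma cylinder_hitting_le:
  fixes P :: "'v::countable \<Rightarrow> 'v \<Rightarrow> real" and X :: "nat \<Rightarrow> 'w \<Rightarrow> 'v"
  assumes M: "markov_chain M X P x0" and P: "\<And>x y. 0 \<le> P x y" "\<And>x. finite {y. P x y \<noteq> 0}"
  shows "measure M {\<omega> \<in> space M. (\<forall>i\<le>m. X i \<omega> = w i) \<and> (\<exists>j\<in>{m..m + n}. X j \<omega> = a)}
    \<le> measure M {\<omega> \<in> space M. \<forall>i\<le>m. X i \<omega> = w i} * hitting_prob P a n (w m)"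
proof (induction n arbitrary: m w)
  interpret prob_space M using M by (simp add: markov_chain_def)
  have [measurable]: "X i \<in> measurable M (count_space UNIV)" for i
    using M by (simp add: markov_chain_def)
  let ?C = "\<lambda>m w. {\<omega> \<in> space M. \<forall>i\<le>m. X i \<omega> = w i}"
  have hit: "measure M {\<omega> \<in> space M. (\<forall>i\<le>m. X i \<omega> = w i) \<and> (\<exists>j\<in>{m..m + n}. X j \<omega> = a)}
    \<le> measure M (?C m w)" for m n w
    by (intro finite_measure_mono) auto
  {
    case 0
    show ?case
    proof (cases "w m = a")
      case True
      then show ?thesis using hit[of m w 0] by simp
    next
      case False
      then have "{\<omega> \<in> space M. (\<forall>i\<le>m. X i \<omega> = w i) \<and> (\<exists>j\<in>{m..m + 0}. X j \<omega> = a)} = {}" by auto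
      then show ?thesis using False by (simp only: measure_empty) simp
    qed
  next
    case (Suc n)
    show ?case
    proof (cases "w m = a")
      case True
      then show ?thesis using hit[of m w "Suc n"] by simp
    next
      case False
      then have "{\<omega> \<in> space M. (\<forall>i\<le>m. X i \<omega> = w i) \<and> (\<exists>j\<in>{m..m + Suc n}. X j \<omega> = a)}
        = {\<omega> \<in> space M. (\<forall>i\<le>m. X i \<omega> = w i) \<and> (\<exists>j\<in>{Suc m..Suc m + n}. X j \<omega> = a)}"
      proof -
        have "{m..m + Suc n} = insert m {Suc m..Suc m + n}" by auto
        then show ?thesis using False by auto
      qed
      then show ?thesis using cylinder_return_le[OF M P Suc] False by simp
    qed
  }
qed

section \<open>Return to a recurrent state\<close>

text \<open>Infinitely many visits include one at a positive time, so a recurrent chain returns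
  almost surely. The sum bounds the probability of returning within \<open>Suc n\<close> steps, and
  continuity from below passes to the limit.\<close>

lemma recurrent_return_prob:
  fixes P :: "'v::countable \<Rightarrow> 'v \<Rightarrow> real"
  assumes P: "stochastic_matrix P" "\<And>x. finite {y. P x y \<noteq> 0}"
    and rec: "recurrent_state P a"
    and le: "\<And>n. (\<Sum>y | P a y \<noteq> 0. P a y * hitting_prob P a n y) \<le> c"
  shows "1 \<le> c"
proof -
  let ?M = "path_measure P a"
  have M: "markov_chain ?M (\<lambda>n \<omega>. \<omega> n) P a" by (rule markov_chain_path_measure[OF P(1)])
  interpret prob_space ?M using M by (simp add: markov_chain_def)
  have [measurable]: "(\<lambda>\<omega>. \<omega> i) \<in> measurable ?M (count_space UNIV)" for i
    using M by (simp add: markov_chain_def)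
  have nonneg: "0 \<le> P x y" for x y using P by (simp add: stochastic_matrix_def)
  let ?S = "{\<omega> \<in> space ?M. \<omega> 0 = a}"
  \<comment> \<open>The window starts at time \<open>1\<close>, since the chain is at
    \<open>a\<close> at time \<open>0\<close>.\<close>
  let ?H = "\<lambda>n. {\<omega> \<in> space ?M. \<omega> 0 = a \<and> (\<exists>j\<in>{Suc 0..Suc 0 + n}. \<omega> j = a)}"
  let ?R = "{\<omega> \<in> space ?M. infinite {n. \<omega> n = a}}"
  have start: "prob ?S = 1"
  proof -
    have "prob {\<omega> \<in> space ?M. \<forall>i\<le>0. \<omega> i = a} = 1"
      using M unfolding markov_chain_def by (elim conjE allE[of _ 0] allE[of _ "\<lambda>_. a"]) simp
    then show ?thesis by simp
  qed
  have "prob (?H n) \<le> c" for n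
  proof -
    have "prob (?H n) \<le> prob ?S * (\<Sum>y | P a y \<noteq> 0. P a y * hitting_prob P a n y)"
      using cylinder_return_le[OF M nonneg P(2) cylinder_hitting_le[OF M nonneg P(2)], of 0 "\<lambda>_. a" n a]
      by simp
    then show ?thesis using le[of n] start by simp
  qed
  moreover have "(\<lambda>n. prob (?H n)) \<longlonglongrightarrow> prob (\<Union>n. ?H n)"
    by (intro finite_Lim_measure_incseq) (fastforce simp: incseq_def)+
  ultimately have "prob (\<Union>n. ?H n) \<le> c" by (intro LIMSEQ_le_const2) auto
  moreover have "prob (?R \<inter> ?S) = 1"
    using rec start unfolding recurrent_state_def
    by (subst measure_space_inter) (auto simp: prob_space)
  moreover have "prob (?R \<inter> ?S) \<le> prob (\<Union>n. ?H n)"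
  proof (intro finite_measure_mono)
    show "?R \<inter> ?S \<subseteq> (\<Union>n. ?H n)"
    proof
      fix \<omega> assume \<omega>: "\<omega> \<in> ?R \<inter> ?S"
      then have "infinite {n. \<omega> n = a}" by blast
      then obtain j where "0 < j" "\<omega> j = a" unfolding infinite_nat_iff_unbounded by blast
      then have "\<omega> \<in> ?H j" using \<omega> by auto
      then show "\<omega> \<in> (\<Union>n. ?H n)" by blast
    qed
  qed auto
  ultimately show ?thesis by simp
qed

section \<open>Recurrence and the Green function\<close>

text \<open>Both sides equal \<open>1\<close> at \<open>a\<close> and satisfy the same averaging
  relation elsewhere, once \<open>n\<close> is large; at \<open>m = 0\<close> the claim is
  nonnegativity. How large \<open>n\<close> must be depends on \<open>m\<close> and
  \<open>x\<close>.\<close>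

lemma hitting_prob_le_dirichlet_solution:
  fixes b :: "'v \<Rightarrow> 'v \<Rightarrow> 'k::linordered_field"
  assumes b: "weighted_graph b" "locally_finite_graph b" and pos: "\<And>x. 0 < vertex_weight b x"
    and K: "exhaustion b K" and a: "\<And>n. a \<in> K n"
  shows "\<forall>\<^sub>F n in sequentially.
    hitting_prob (real_transition b) a m x \<le> real_part (dirichlet_solution b (K n) a x)"
proof (induction m arbitrary: x)
  define v where "v n = dirichlet_solution b (K n) a" for n
  have Kn: "finite (K n)" "connected_in b (K n)" for n using K by (auto simp: exhaustion_def)
  have v: "is_dirichlet_solution b (K n) a (v n)" for n
    unfolding v_def by (rule is_dirichlet_solution_dirichlet_solution[OF b Kn a])
  note bounds = is_dirichlet_solution_bounds[OF b Kn a v]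
  have v1: "real_part (v n a) = 1" for n
    using v real_part_1 by (simp add: is_dirichlet_solution_def)
  have v0: "0 \<le> real_part (v n x)" for n x
    by (rule infinitely_close_real_part_unit(2)[OF bounds])
  {
    case 0
    show ?case using v0 v1 by (simp add: v_def[symmetric])
  next
    case (Suc m)
    show ?case
    proof (cases "x = a")
      case True
      then show ?thesis using v1 by (simp add: v_def[symmetric])
    next
      case False
      let ?N = "{y. real_transition b x y \<noteq> 0}"
      have sub: "?N \<subseteq> neighbors b x" using real_transition_support[OF b(1)] by blast
      have fin: "finite (neighbors b x)" using b by (simp add: locally_finite_graph_def)
      have "x \<in> (\<Union>n. K n)" using K by (simp add: exhaustion_def)
      then obtain n0 where n0: "x \<in> K n0" by blast
      \<comment> \<open>Harmonicity of \<open>v n\<close> at \<open>x\<close> is available only once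
        \<open>x\<close> lies in \<open>K n\<close>.\<close>
      have "\<forall>\<^sub>F n in sequentially. x \<in> K n"
        using K n0 unfolding exhaustion_def eventually_sequentially incseq_def by blast
      \<comment> \<open>Finiteness of \<open>?N\<close> allows one threshold for all
        successors.\<close>
      moreover have "\<forall>\<^sub>F n in sequentially. \<forall>y\<in>?N.
          hitting_prob (real_transition b) a m y \<le> real_part (v n y)"
        using Suc finite_subset[OF sub fin] unfolding v_def by (intro eventually_ball_finite) auto
      ultimately show ?thesis
      proof eventually_elim
        case (elim n)
        then have "real_part (laplacian b (v n) x) = 0"
          using v[of n] False by (simp add: is_dirichlet_solution_def real_part_0)
        then have "real_part (v n x) = (\<Sum>y\<in>neighbors b x. real_transition b x y * real_part (v n y))"
          using real_part_laplacian[OF b pos bounds] by simp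
        also have "\<dots> = (\<Sum>y\<in>?N. real_transition b x y * real_part (v n y))"
          using fin sub by (intro sum.mono_neutral_right) auto
        also have "\<dots> \<ge> (\<Sum>y\<in>?N. real_transition b x y * hitting_prob (real_transition b) a m y)"
          using elim infinitely_close_real_transition(2)[OF b] by (intro sum_mono mult_left_mono) auto
        finally show ?case using False by (simp add: v_def)
      qed
    qed
  }
qed

text \<open>A finite value of \<open>green\<close> below \<open>C\<close> would keep the probability
  of return within any number of steps at most \<open>1 - 1 / C\<close>, contradicting
  \<open>recurrent_return_prob\<close>.\<close>

lemma recurrent_imp_green_infinite:
  fixes b :: "'v::countable \<Rightarrow> 'v \<Rightarrow> 'k::linordered_field"
  assumes b: "weighted_graph b" "locally_finite_graph b" and conn: "connected_in b UNIV"
    and K: "exhaustion b K" and a: "a \<in> K 0"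
    and rec: "recurrent_state (real_transition b) a"
  shows "green b K a = \<infinity>"
proof (cases "\<exists>y. y \<noteq> a")
  case False
  \<comment> \<open>With a single vertex the total weight is \<open>0\<close>, so the capacity
    quotient is \<open>0\<close> by the convention for division by zero, and its inverse in
    \<open>ereal\<close> is infinite.\<close>
  then have "b a y = 0" for y using b by (metis weighted_graph_def)
  then have "neighbors b a = {}" by (simp add: neighbors_def)
  then have "vertex_weight b a = 0" by (simp add: vertex_weight_def)
  then have "green_on b (K n) a = \<infinity>" for n by (simp add: green_on_def real_part_0)
  then show ?thesis by (simp add: green_def Limsup_const)
next
  case True
  have pos: "0 < vertex_weight b x" for x
  proof -
    obtain y where "x \<noteq> y" using True by metis
    then show ?thesis by (intro vertex_weight_pos_connected[OF b conn, of x y]) auto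
  qed
  let ?P = "real_transition b"
  have aK: "a \<in> K n" for n
    using K a unfolding exhaustion_def incseq_def by blast
  define v where "v n = dirichlet_solution b (K n) a" for n
  have Kn: "finite (K n)" "connected_in b (K n)" for n using K by (auto simp: exhaustion_def)
  have v: "is_dirichlet_solution b (K n) a (v n)" for n
    unfolding v_def by (rule is_dirichlet_solution_dirichlet_solution[OF b Kn aK])
  note bounds = is_dirichlet_solution_bounds[OF b Kn aK v]
  have v1: "real_part (v n a) = 1" for n
    using v real_part_1 by (simp add: is_dirichlet_solution_def)
  let ?N = "{y. ?P a y \<noteq> 0}"
  have sub: "{y. ?P x y \<noteq> 0} \<subseteq> neighbors b x" for x using real_transition_support[OF b(1)] by blast
  have fin: "finite (neighbors b x)" for x using b by (simp add: locally_finite_graph_def)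
  have finP: "finite {y. ?P x y \<noteq> 0}" for x by (rule finite_subset[OF sub fin])
  have stoch: "stochastic_matrix ?P" by (rule stochastic_matrix_real_transition[OF b pos])
  have cap: "real_part (capacity b (K n) a / vertex_weight b a)
      = 1 - (\<Sum>y\<in>?N. ?P a y * real_part (v n y))" for n
  proof -
    have "capacity b (K n) a / vertex_weight b a = laplacian b (v n) a"
      using pos[of a] by (simp add: capacity_def v_def)
    moreover have "(\<Sum>y\<in>neighbors b a. ?P a y * real_part (v n y)) = (\<Sum>y\<in>?N. ?P a y * real_part (v n y))"
      using fin sub by (intro sum.mono_neutral_right) auto
    moreover have "real_part (laplacian b (v n) a)
        = real_part (v n a) - (\<Sum>y\<in>neighbors b a. ?P a y * real_part (v n y))"
      by (rule real_part_laplacian[OF b pos bounds])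
    ultimately show ?thesis using v1[of n] by simp
  qed
  \<comment> \<open>Excludes negative values \<open>r\<close>, for which \<open>1 / r < C\<close>
    would carry no information.\<close>
  have cap_nonneg: "0 \<le> real_part (capacity b (K n) a / vertex_weight b a)" for n
  proof -
    have "(\<Sum>y\<in>?N. ?P a y * real_part (v n y)) \<le> (\<Sum>y\<in>?N. ?P a y)"
      using infinitely_close_real_transition(2)[OF b] infinitely_close_real_part_unit(3)[OF bounds]
      by (intro sum_mono mult_left_le) auto
    also have "\<dots> = 1"
    proof -
      have "(?P a has_sum 1) UNIV" using stoch by (simp add: stochastic_matrix_def)
      moreover have "(?P a has_sum sum (?P a) ?N) UNIV"
        using finP by (intro has_sum_finite_neutralI[of ?N]) auto
      ultimately show ?thesis using has_sum_unique by blast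
    qed
    finally show ?thesis by (simp add: cap)
  qed
  show ?thesis
  proof (rule ccontr)
    assume "green b K a \<noteq> \<infinity>"
    then obtain C :: nat where "green b K a < ereal C" using less_PInf_Ex_of_nat by blast
    then have "\<forall>\<^sub>F n in sequentially. green_on b (K n) a < ereal C"
      unfolding green_def by (rule Limsup_lessD)
    then have ev: "\<forall>\<^sub>F n in sequentially. 0 < real C \<and>
        (\<Sum>y\<in>?N. ?P a y * real_part (v n y)) \<le> 1 - 1 / C"
    proof eventually_elim
      case (elim n)
      define r where "r = real_part (capacity b (K n) a / vertex_weight b a)"
      \<comment> \<open>At \<open>r = 0\<close> the value of \<open>green_on\<close> would be
        infinite.\<close>
      have "r \<noteq> 0" using elim by (auto simp: green_on_def r_def divide_ereal_def)
      then have "0 < r" using cap_nonneg[of n] by (simp add: r_def)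
      then have "1 / r < C" using elim by (simp add: green_on_def r_def one_ereal_def)
      moreover have "0 < 1 / r" using \<open>0 < r\<close> by simp
      ultimately have "0 < real C" by linarith
      moreover from this have "1 / C \<le> r"
        using \<open>1 / r < C\<close> \<open>0 < r\<close> by (simp add: field_simps)
      ultimately show ?case using cap[of n] by (simp add: r_def)
    qed
    \<comment> \<open>For fixed \<open>m\<close>, a single large \<open>n\<close> suffices; the
      resulting bound no longer involves \<open>n\<close>.\<close>
    have "(\<Sum>y\<in>?N. ?P a y * hitting_prob ?P a m y) \<le> 1 - 1 / C" for m
    proof -
      have "\<forall>\<^sub>F n in sequentially. \<forall>y\<in>?N. hitting_prob ?P a m y \<le> real_part (v n y)"
        using hitting_prob_le_dirichlet_solution[OF b pos K aK] finP
        unfolding v_def by (intro eventually_ball_finite) auto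
      with ev have "\<forall>\<^sub>F n in sequentially. (\<Sum>y\<in>?N. ?P a y * hitting_prob ?P a m y) \<le> 1 - 1 / C"
      proof eventually_elim
        case (elim n)
        then have "(\<Sum>y\<in>?N. ?P a y * hitting_prob ?P a m y) \<le> (\<Sum>y\<in>?N. ?P a y * real_part (v n y))"
          using infinitely_close_real_transition(2)[OF b] by (intro sum_mono mult_left_mono) auto
        then show ?case using elim by linarith
      qed
      then show ?thesis by simp
    qed
    then have "1 \<le> 1 - 1 / real C" by (rule recurrent_return_prob[OF stoch finP rec])
    moreover have "0 < real C" using eventually_happens[OF ev] by auto
    ultimately show False by simp
  qed
qed

theorem corollary5p2:
  fixes b :: "'v::countable \<Rightarrow> 'v \<Rightarrow> 'k::linordered_field"
    and K :: "nat \<Rightarrow> 'v set"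
    and a :: 'v
  assumes "weighted_graph b"
    and "connected_in b UNIV"
    and "locally_finite_graph b"
    and "exhaustion b K"
    and "a \<in> K 0"
  shows "(recurrent_state (real_transition b) a \<longrightarrow> green b K a = \<infinity>) \<and>
         (green b K a < \<infinity> \<longrightarrow> transient_state (real_transition b) a)"
  using recurrent_imp_green_infinite[OF assms(1,3,2,4,5)]
  unfolding transient_state_def by auto

end
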